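(* Let $d\ge2$, let $C\subseteq\mathbb R^d$ be a closed salient convex cone with order unit $u\in{\rm int}(C)$, let $H\subseteq\mathbb R^d$ be a linear hyperplane with $H\cap C=\{0\}$, and assume that $C\cap(u+H)$ is symmetric with respect to $u$ (i.e. $x\in C\cap(u+H)$ implies $2u-x\in C\cap (u+H)$). Then with $\nu=1/(d-1)$ the inclusion $(\nu\!\uparrow\! C)^{\max}\subseteq C^{\min}$ holds, i.e. $(\nu\!\uparrow\! C)^{\max}_s\subseteq C^{\min}_s$ for all $s\ge1$.
   Context: ${\rm Her}_s(\mathbb C)$ denotes the Hermitian $s\times s$ matrices; $\geqslant 0$ denotes positive semidefiniteness. A convex cone $C$ is salient if $C\cap(-C)=\{0\}$. For $c\in\mathbb R^d$ and $P\in{\rm Her}_s(\mathbb C)$, $c\otimes P:=(c_1P,\ldots,c_dP)$. For a closed salient convex cone $C\subseteq\mathbb R^d$ with nonempty interior and $s\ge1$, $$C_s^{\min}:=\Big\{\sum_i c_i\otimes P_i\ \text{(finite sums)}\ \Big|\ c_i\in C,\ P_i\in{\rm Her}_s(\mathbb C),\ P_i\geqslant0\Big\},$$ $$C_s^{\max}:=\{(A_1,\ldots,A_d)\in{\rm Her}_s(\mathbb C)^d\mid (v^*A_1v,\ldots,v^*A_dv)\in C\ \text{ for all } v\in\mathbb C^s\}.$$ Given a linear hyperplane $H$ with $H\cap C=\{0\}$, an order unit $u\in{\rm int}(C)$, and $\nu>0$, the scaled cone $\nu\!\uparrow\! C$ is the conical hull (including the origin) of $\{u+\nu(x-u)\mid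 x\in C\cap(u+H)\}$, i.e. of the set obtained by scaling $C\cap(u+H)$ by the factor $\nu$ from the point $u$. *)

theory Defs
  imports "HOL-Analysis.Analysis"
begin

text \<open>
  Complex \<open>s \<times> s\<close> matrices are elements of \<open>complex^'s^'s\<close> with \<open>s = CARD('s)\<close>, and
  \<open>d\<close>-tuples of such matrices are elements of \<open>(complex^'s^'s)^'d\<close> with \<open>d = CARD('d)\<close>.
\<close>

definition hermitian :: "complex^'s^'s \<Rightarrow> bool" where
  "hermitian A \<longleftrightarrow> (\<forall>i j. A $ i $ j = cnj (A $ j $ i))"

text \<open>The value \<open>v\<^sup>* A v\<close>.\<close>

definition quad_form :: "complex^'s^'s \<Rightarrow> complex^'s \<Rightarrow> complex" where
  "quad_form A v = (\<Sum>i\<in>UNIV. cnj (v $ i) * (A *v v) $ i)"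

text \<open>
  For Hermitian \<open>A\<close> the number \<open>v\<^sup>* A v\<close> is real, so the uses of \<open>Re\<close> below, which are
  all guarded by \<open>hermitian\<close>, lose no information.
\<close>

lemma quad_form_hermitian_real:
  assumes "hermitian A"
  shows "quad_form A v \<in> \<real>"
proof -
  have h: "cnj (A $ i $ j) = A $ j $ i" for i j
    using assms unfolding hermitian_def by metis
  have "cnj (quad_form A v) = (\<Sum>i\<in>UNIV. \<Sum>j\<in>UNIV. v $ i * (A $ j $ i * cnj (v $ j)))"
    unfolding quad_form_def matrix_vector_mult_def by (simp add: sum_distrib_left h)
  also have "\<dots> = (\<Sum>j\<in>UNIV. \<Sum>i\<in>UNIV. v $ i * (A $ j $ i * cnj (v $ j)))"
    by (rule sum.swap)
  also have "\<dots> = quad_form A v"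
    unfolding quad_form_def matrix_vector_mult_def by (simp add: sum_distrib_left mult_ac)
  finally show ?thesis
    by (simp add: Reals_cnj_iff)
qed

definition psd :: "complex^'s^'s \<Rightarrow> bool" where
  "psd P \<longleftrightarrow> hermitian P \<and> (\<forall>v. 0 \<le> Re (quad_form P v))"

definition tensor :: "real^'d \<Rightarrow> complex^'s^'s \<Rightarrow> (complex^'s^'s)^'d" where
  "tensor c P = (\<chi> k. (c $ k) *\<^sub>R P)"

definition min_system :: "(real^'d) set \<Rightarrow> ((complex^'s^'s)^'d) set" where
  "min_system C =
     {\<Sum>i<n. tensor (c i) (P i) | (n :: nat) c P. \<forall>i<n. c i \<in> C \<and> psd (P i)}"

definition max_system :: "(real^'d) set \<Rightarrow> ((complex^'s^'s)^'d) set" where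
  "max_system C =
     {A. (\<forall>k. hermitian (A $ k)) \<and> (\<forall>v. (\<chi> k. Re (quad_form (A $ k) v)) \<in> C)}"

text \<open>
  The library predicate \<^const>\<open>cone\<close> means closed under scaling by nonnegative reals; it
  holds of the empty set, so membership of the origin is required separately.
\<close>

definition conical_hull :: "'a::real_vector set \<Rightarrow> 'a set" where
  "conical_hull S = (\<lambda>T. convex T \<and> cone T \<and> 0 \<in> T) hull S"

definition scaled_cone ::
    "(real^'d) set \<Rightarrow> real^'d \<Rightarrow> real \<Rightarrow> (real^'d) set \<Rightarrow> (real^'d) set" where
  "scaled_cone H u \<nu> C =
     conical_hull ((\<lambda>x. u + \<nu> *\<^sub>R (x - u)) ` (C \<inter> (+) u ` H))"

definition salient :: "'a::real_vector set \<Rightarrow> bool" where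
  "salient C \<longleftrightarrow> C \<inter> uminus ` C = {0}"

end

theory Submission
  imports Defs
begin

text \<open>
  Put \<open>n = d - 1\<close> and \<open>K = (C \<inter> (u + H)) - u\<close>, a symmetric convex body in \<open>H\<close>. An Auerbach basis
  of \<open>K\<close> (rows of a matrix of maximal \<open>\<bar>det\<bar>\<close>) gives \<open>x\<^sub>1, \<dots>, x\<^sub>n \<in> K\<close> whose coordinate
  functionals are bounded by \<open>1\<close> on \<open>K\<close>. In the basis \<open>u, x\<^sub>1, \<dots>, x\<^sub>n\<close> a tuple \<open>A\<close> has matrix
  coordinates \<open>A\<^sub>0', A\<^sub>1', \<dots>, A\<^sub>n'\<close>, and if \<open>A\<close> lies in the maximal system of the cone scaled by
  \<open>1/n\<close>, then \<open>- A\<^sub>0'/n \<le> A\<^sub>i' \<le> A\<^sub>0'/n\<close>. Hence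
  \<open>A = \<Sum>\<^sub>i (u + x\<^sub>i) \<otimes> (A\<^sub>0'/n + A\<^sub>i')/2 + (u - x\<^sub>i) \<otimes> (A\<^sub>0'/n - A\<^sub>i')/2\<close> is a separable decomposition.
\<close>

section \<open>Auerbach bases by determinant maximisation\<close>

lemma compact_vec_Pi:
  fixes S :: "'n::finite \<Rightarrow> ('a::euclidean_space) set"
  assumes "\<And>i. compact (S i)"
  shows "compact {X :: 'a^'n. \<forall>i. X $ i \<in> S i}"
proof -
  have "\<exists>b. \<forall>x\<in>S i. norm x \<le> b" for i
    using assms[of i] compact_imp_bounded bounded_iff by blast
  then obtain b where b: "\<And>i x. x \<in> S i \<Longrightarrow> norm x \<le> b i" by metis
  have "norm X \<le> sum b UNIV" if "\<forall>i. X $ i \<in> S i" for X :: "'a^'n"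
  proof -
    have "norm X \<le> (\<Sum>i\<in>UNIV. norm (X $ i))"
      unfolding norm_vec_def by (rule L2_set_le_sum) simp
    also have "\<dots> \<le> sum b UNIV" by (rule sum_mono) (use that b in blast)
    finally show ?thesis .
  qed
  then have "bounded {X :: 'a^'n. \<forall>i. X $ i \<in> S i}"
    unfolding bounded_iff by blast
  moreover have "closed {X :: 'a^'n. \<forall>i. X $ i \<in> S i}"
  proof (rule closed_Collect_all)
    fix i
    have "closed ((\<lambda>X :: 'a^'n. X $ i) -` S i)"
      by (intro closed_vimage compact_imp_closed assms continuous_intros)
    then show "closed {X :: 'a^'n. X $ i \<in> S i}" by (simp add: vimage_def)
  qed
  ultimately show ?thesis by (simp add: compact_eq_bounded_closed)
qed

text \<open>By Cramer's rule, replacing row \<open>i\<close> of \<open>X\<close> by \<open>a\<close>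
  multiplies the determinant by the \<open>i\<close>-th coordinate of \<open>a\<close> in the basis
  of rows. If \<bar>\<open>det X\<close>\<bar> is maximal, that factor is at most 1 in absolute
  value. \<open>X0\<close> ensures that the maximum is nonzero. The constraint set depends on the
  row so that one row can be held fixed.\<close>

lemma auerbach:
  fixes S :: "'d::finite \<Rightarrow> (real^'d) set" and X0 :: "real^'d^'d"
  assumes "\<And>i. compact (S i)" and X0: "\<And>i. X0 $ i \<in> S i" "det X0 \<noteq> 0"
  obtains X B :: "real^'d^'d"
  where "\<And>i. X $ i \<in> S i" "X ** B = mat 1" "B ** X = mat 1"
    "\<And>i a. a \<in> S i \<Longrightarrow> \<bar>(a v* B) $ i\<bar> \<le> 1"
proof -
  let ?T = "{X :: real^'d^'d. \<forall>i. X $ i \<in> S i}"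
  have "continuous_on ?T (\<lambda>X. \<bar>det X\<bar>)"
    unfolding det_def by (intro continuous_intros)
  then obtain X where X: "X \<in> ?T" and max: "\<And>Y. Y \<in> ?T \<Longrightarrow> \<bar>det Y\<bar> \<le> \<bar>det X\<bar>"
    using continuous_attains_sup[of ?T "\<lambda>X. \<bar>det X\<bar>"] compact_vec_Pi[of S] assms by auto
  have "\<bar>det X0\<bar> \<le> \<bar>det X\<bar>" by (rule max) (simp add: X0)
  then have D: "det X \<noteq> 0" using X0 by auto
  then obtain B where B: "X ** B = mat 1" "B ** X = mat 1"
    using invertible_det_nz[of X] unfolding invertible_def by blast
  have "\<bar>(a v* B) $ i\<bar> \<le> 1" if a: "a \<in> S i" for i a
  proof -
    let ?x = "a v* B"
    have "(\<Sum>j\<in>UNIV. ?x $ j *s row j X) = ?x v* X"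
      by (simp add: vec_eq_iff vector_matrix_mult_def row_def mult.commute)
    also have "\<dots> = a" by (simp add: vector_matrix_mul_assoc B)
    finally have "(\<Sum>j\<in>UNIV. ?x $ j *s row j X) = a" .
    then have "det (\<chi> j. if j = i then a else row j X) = ?x $ i * det X"
      using cramer_lemma_transpose[of i ?x X] by (simp only:)
    moreover have "\<bar>det (\<chi> j. if j = i then a else row j X)\<bar> \<le> \<bar>det X\<bar>"
      by (rule max) (use X a in \<open>simp add: row_def\<close>)
    ultimately show ?thesis using D by (simp add: abs_mult)
  qed
  then show thesis using that X B by blast
qed

section \<open>Quadratic forms and the two matrix systems\<close>

lemma linear_quad_form: "linear (\<lambda>A. quad_form A v)"
proof (rule linearI)
  show "quad_form (A + B) v = quad_form A v + quad_form B v" for A B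
    by (simp add: quad_form_def matrix_vector_mult_add_rdistrib distrib_left sum.distrib)
  have "(c *\<^sub>R A) *v v = c *\<^sub>R (A *v v)" for c and A :: "complex^'a^'a"
    by (simp add: vec_eq_iff matrix_vector_mult_def scaleR_sum_right)
  then show "quad_form (c *\<^sub>R A) v = c *\<^sub>R quad_form A v" for c A
    by (simp add: quad_form_def scaleR_sum_right)
qed

lemma Re_quad_form_sum:
  "Re (quad_form (\<Sum>k\<in>S. c k *\<^sub>R A k) v) = (\<Sum>k\<in>S. c k * Re (quad_form (A k) v))"
  by (simp add: linear_sum[OF linear_quad_form] linear_scale[OF linear_quad_form])

lemma hermitian_sum:
  assumes "\<And>k. k \<in> S \<Longrightarrow> hermitian (A k)"
  shows "hermitian (\<Sum>k\<in>S. c k *\<^sub>R A k)"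
  unfolding hermitian_def
proof (intro allI)
  fix i j
  have "A k $ i $ j = cnj (A k $ j $ i)" if "k \<in> S" for k
    using assms[OF that] unfolding hermitian_def by blast
  then have "(\<Sum>k\<in>S. c k *\<^sub>R A k $ i $ j) = (\<Sum>k\<in>S. c k *\<^sub>R cnj (A k $ j $ i))"
    by (intro sum.cong) simp_all
  then show "(\<Sum>k\<in>S. c k *\<^sub>R A k) $ i $ j = cnj ((\<Sum>k\<in>S. c k *\<^sub>R A k) $ j $ i)"
    by simp
qed

text \<open>Applying \<open>z\<close> commutes with taking quadratic forms, so a functional in the
  dual cone turns the tuple into a single positive semidefinite matrix.\<close>

lemma psd_combination_of_max_system:
  assumes "A \<in> max_system C" and "\<And>a. a \<in> C \<Longrightarrow> 0 \<le> z \<bullet> a"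
  shows "psd (\<Sum>k\<in>UNIV. z $ k *\<^sub>R A $ k)"
  unfolding psd_def
proof (intro conjI allI)
  show "hermitian (\<Sum>k\<in>UNIV. z $ k *\<^sub>R A $ k)"
    by (rule hermitian_sum) (use assms in \<open>simp add: max_system_def\<close>)
  fix v
  have "0 \<le> z \<bullet> (\<chi> k. Re (quad_form (A $ k) v))"
    using assms by (simp add: max_system_def)
  then show "0 \<le> Re (quad_form (\<Sum>k\<in>UNIV. z $ k *\<^sub>R A $ k) v)"
    by (simp add: Re_quad_form_sum inner_vec_def)
qed

lemma sum_in_min_system:
  assumes "finite S" and "\<And>i. i \<in> S \<Longrightarrow> c i \<in> C" and "\<And>i. i \<in> S \<Longrightarrow> psd (P i)"
  shows "(\<Sum>i\<in>S. tensor (c i) (P i)) \<in> min_system C"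
proof -
  obtain h where h: "bij_betw h {0..<card S} S"
    using ex_bij_betw_nat_finite[OF assms(1)] by blast
  have "(\<Sum>i\<in>S. tensor (c i) (P i)) = (\<Sum>i<card S. tensor (c (h i)) (P (h i)))"
    using sum.reindex_bij_betw[OF h, of "\<lambda>i. tensor (c i) (P i)"]
    by (simp add: atLeast0LessThan)
  moreover have "h i \<in> S" if "i < card S" for i
    using bij_betwE[OF h] that by simp
  then have "\<forall>i<card S. c (h i) \<in> C \<and> psd (P (h i))"
    using assms by blast
  ultimately show ?thesis
    unfolding min_system_def by (intro CollectI exI conjI)
qed

section \<open>Cones, their sections and transversal bases\<close>

lemma conical_hull_subset_halfspace:
  assumes "\<And>a. a \<in> S \<Longrightarrow> 0 \<le> z \<bullet> a" and "a \<in> conical_hull S"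
  shows "0 \<le> z \<bullet> a"
proof -
  have "conical_hull S \<subseteq> {a. 0 \<le> z \<bullet> a}"
    unfolding conical_hull_def
  proof (rule hull_minimal)
    show "convex {a. 0 \<le> z \<bullet> a} \<and> cone {a. 0 \<le> z \<bullet> a} \<and> 0 \<in> {a. 0 \<le> z \<bullet> a}"
      by (simp add: convex_halfspace_ge[of 0 z, simplified] cone_def)
  qed (use assms in auto)
  then show ?thesis using assms by blast
qed

lemma cone_with_origin_interior:
  fixes C :: "'a::real_normed_vector set"
  assumes "cone C" and "0 \<in> interior C"
  shows "C = UNIV"
proof -
  obtain r where r: "r > 0" "cball 0 r \<subseteq> C"
    using assms(2) mem_interior_cball by blast
  have "x \<in> C" for x
  proof (cases "x = 0")
    case False
    then have "(r / norm x) *\<^sub>R x \<in> C" using r by (intro subsetD[OF r(2)]) simp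
    then have "(norm x / r) *\<^sub>R (r / norm x) *\<^sub>R x \<in> C"
      using assms(1) r unfolding cone_def by (meson divide_nonneg_pos norm_ge_zero)
    then show ?thesis using False r by simp
  qed (use r in auto)
  then show ?thesis by blast
qed

text \<open>On the unit vectors of \<open>C\<close> the continuous function
  \<bar>\<open>w \<bullet> x\<close>\<bar> has no zero, hence a positive lower bound
  \<open>m\<close>; by homogeneity the section lies in the ball of radius
  \<bar>\<open>b\<close>\<bar>\<open>/m\<close>.\<close>

lemma compact_cone_section:
  fixes C :: "'a::euclidean_space set"
  assumes "closed C" "cone C" and tr: "\<And>x. x \<in> C \<Longrightarrow> w \<bullet> x = 0 \<Longrightarrow> x = 0"
  shows "compact (C \<inter> {x. w \<bullet> x = b})"
proof -
  let ?S = "C \<inter> sphere 0 1"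
  obtain m where m: "m > 0" "\<And>x. x \<in> ?S \<Longrightarrow> m \<le> \<bar>w \<bullet> x\<bar>"
  proof (cases "?S = {}")
    case True
    then show ?thesis by (intro that[of 1]) auto
  next
    case False
    have "compact ?S" using assms(1) by (simp add: closed_Int_compact)
    moreover have "continuous_on ?S (\<lambda>x. \<bar>w \<bullet> x\<bar>)" by (intro continuous_intros)
    ultimately obtain y where y: "y \<in> ?S" "\<And>x. x \<in> ?S \<Longrightarrow> \<bar>w \<bullet> y\<bar> \<le> \<bar>w \<bullet> x\<bar>"
      using continuous_attains_inf[of ?S "\<lambda>x. \<bar>w \<bullet> x\<bar>"] False by blast
    show ?thesis by (rule that[of "\<bar>w \<bullet> y\<bar>"]) (use y tr[of y] in auto)
  qed
  have "norm x \<le> \<bar>b\<bar> / m" if x: "x \<in> C" "w \<bullet> x = b" for x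
  proof (cases "x = 0")
    case False
    have "inverse (norm x) *\<^sub>R x \<in> ?S"
      using x False assms(2) by (auto simp: cone_def)
    from m(2)[OF this] have "m \<le> \<bar>b\<bar> / norm x"
      using x by (simp add: abs_mult divide_inverse mult.commute)
    then show ?thesis using m False by (simp add: field_simps)
  qed (use m in simp)
  then have "bounded (C \<inter> {x. w \<bullet> x = b})" unfolding bounded_iff by blast
  moreover have "closed (C \<inter> {x. w \<bullet> x = b})"
    using assms(1) by (intro closed_Int closed_hyperplane)
  ultimately show ?thesis by (simp add: compact_eq_bounded_closed)
qed

text \<open>Supplies the nondegenerate starting matrix for \<open>auerbach\<close>: the unit vectors
  other than the \<open>k\<close>-th are projected along \<open>u\<close> onto the kernel of
  \<open>w\<close> and shrunk. Since \<open>u $ k\<close> is nonzero, \<open>u\<close> can take the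
  place of the missing unit vector.\<close>

lemma exists_transversal_basis:
  fixes u w :: "real^'d"
  assumes "0 < r" "w \<bullet> u = 1" "u $ k \<noteq> 0"
  obtains X :: "real^'d^'d" where "X $ k = u" "det X \<noteq> 0"
    "\<And>i. i \<noteq> k \<Longrightarrow> w \<bullet> X $ i = 0 \<and> norm (X $ i) \<le> r"
proof -
  define h where "h i = axis i 1 - w $ i *\<^sub>R u" for i
  \<comment> \<open>The summand 1 avoids division by zero and still keeps the scaled vector within
    norm \<open>r\<close>.\<close>
  define e where "e i = r / (norm (h i) + 1)" for i
  have e: "0 < e i" for i
    unfolding e_def using assms(1) by (simp add: add_nonneg_pos)
  define X :: "real^'d^'d" where "X = (\<chi> i. if i = k then u else e i *\<^sub>R h i)"
  have "y = 0" if "X *v y = 0" for y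
  proof -
    have row: "X $ i \<bullet> y = 0" for i
      using that by (metis matrix_vector_mul_component zero_index)
    have u: "u \<bullet> y = 0" using row[of k] by (simp add: X_def)
    have yi: "y $ i = 0" if "i \<noteq> k" for i
      using row[of i] that e[of i] u
      by (simp add: X_def h_def inner_diff_left inner_axis' )
    have "u \<bullet> y = (\<Sum>i\<in>UNIV. if i = k then u $ k * y $ k else 0)"
      unfolding inner_vec_def by (rule sum.cong) (auto simp: yi)
    then have "y $ k = 0" using u assms(3) by simp
    then show ?thesis using yi by (metis vec_eq_iff zero_index)
  qed
  then have "det X \<noteq> 0"
    by (metis invertible_det_nz invertible_left_inverse matrix_left_invertible_ker)
  moreover have "w \<bullet> X $ i = 0 \<and> norm (X $ i) \<le> r" if "i \<noteq> k" for i
  proof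
    show "w \<bullet> X $ i = 0"
      using that assms(2) by (simp add: X_def h_def inner_diff_right inner_axis)
    have "norm (X $ i) = r * (norm (h i) / (norm (h i) + 1))"
      using that assms(1) by (simp add: X_def e_def abs_of_nonneg)
    also have "\<dots> \<le> r * 1"
      using assms(1) by (intro mult_left_mono) (simp_all add: divide_le_eq_1 add_nonneg_pos)
    finally show "norm (X $ i) \<le> r" by simp
  qed
  ultimately show thesis using that[of X] by (simp add: X_def)
qed

theorem theorem5p8:
  fixes C H :: "(real^'d) set" and u :: "real^'d" and \<nu> :: real
  assumes "CARD('d) \<ge> 2"
    and "closed C" and "convex C" and "cone C" and "salient C"
    and "u \<in> interior C"
    and "subspace H" and "dim H = CARD('d) - 1"
    and "H \<inter> C = {0}"
    and "\<And>x. x \<in> C \<inter> (+) u ` H \<Longrightarrow> 2 *\<^sub>R u - x \<in> C \<inter> (+) u ` H"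
    and "\<nu> = 1 / (real CARD('d) - 1)"
  shows "(max_system (scaled_cone H u \<nu> C) :: ((complex^'s^'s)^'d) set) \<subseteq> min_system C"
proof
  fix A :: "(complex^'s^'s)^'d"
  assume A: "A \<in> max_system (scaled_cone H u \<nu> C)"
  have uC: "u \<in> C" using assms(6) interior_subset by blast
  \<comment> \<open>Otherwise \<open>u = 0\<close> is interior to \<open>C\<close>, which forces
    \<open>C = UNIV\<close> and \<open>H = {0}\<close>, against
    \<open>dim H = d - 1 \<ge> 1\<close>.\<close>
  have uH: "u \<notin> H"
  proof
    assume "u \<in> H"
    then have "u = 0" using uC assms(9) by blast
    then have "C = UNIV" using cone_with_origin_interior assms(4,6) by blast
    then have "H = {0}" using assms(9) by simp
    then show False using assms(1,8) by simp
  qed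
  have "dim H = DIM(real^'d) - 1" using assms(8) by simp
  then obtain w0 where w0: "H = {x. w0 \<bullet> x = 0}"
    by (metis assms(7) dim_eq_hyperplane span_eq_iff)
  \<comment> \<open>Normalised so that \<open>u + H\<close> is the level set of \<open>w\<close> at
    1.\<close>
  define w where "w = (1 / (w0 \<bullet> u)) *\<^sub>R w0"
  have wH: "H = {x. w \<bullet> x = 0}" and wu: "w \<bullet> u = 1"
    using uH w0 by (auto simp: w_def)
  then have uH_eq: "(+) u ` H = {x. w \<bullet> x = 1}"
    by (auto simp: inner_add_right inner_diff_right intro!: image_eqI[of _ _ "_ - u"])
  obtain k where k: "u $ k \<noteq> 0"
    using wu by (metis inner_zero_right vec_eq_iff zero_index zero_neq_one)
  obtain r where r: "r > 0" "cball u r \<subseteq> C"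
    using assms(6) mem_interior_cball by blast
  define K where "K = (\<lambda>x. - u + x) ` (C \<inter> (+) u ` H)"
  have K_iff: "x \<in> K \<longleftrightarrow> u + x \<in> C \<and> w \<bullet> x = 0" for x
    unfolding K_def uH_eq using wu
    by (auto simp: inner_add_right inner_diff_right intro!: image_eqI[of _ _ "u + x"])
  \<comment> \<open>The symmetry hypothesis enters here:
    \<open>2u - (u + x) = u - x\<close>.\<close>
  have Kminus: "u - x \<in> C" if "x \<in> K" for x
    using that assms(10)[of "u + x"] wu
    by (simp add: K_iff uH_eq inner_add_right scaleR_2)
  have compactK: "compact K"
    unfolding K_def uH_eq
    by (intro compact_translation compact_cone_section assms) (use assms(9) wH in auto)
  obtain X0 where X0: "X0 $ k = u" "det X0 \<noteq> 0"
    "\<And>i. i \<noteq> k \<Longrightarrow> w \<bullet> X0 $ i = 0 \<and> norm (X0 $ i) \<le> r"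
    using exists_transversal_basis[OF r(1) wu k] by blast
  have X0K: "X0 $ i \<in> K" if "i \<noteq> k" for i
    using X0(3)[OF that] by (auto simp: K_iff dist_norm intro!: subsetD[OF r(2)])
  \<comment> \<open>Only the rows other than \<open>k\<close> vary in the maximisation; row
    \<open>k\<close> stays at the order unit.\<close>
  define S where "S i = (if i = k then {u} else K)" for i
  have "compact (S i)" "X0 $ i \<in> S i" for i
    using compactK X0(1) X0K by (auto simp: S_def)
  then obtain X B where XS: "\<And>i. X $ i \<in> S i" and XB: "X ** B = mat 1" "B ** X = mat 1"
    and bound: "\<And>i a. a \<in> S i \<Longrightarrow> \<bar>(a v* B) $ i\<bar> \<le> 1"
    using auerbach[of S X0] X0(2) by blast
  have Xk: "X $ k = u" and XK: "\<And>i. i \<noteq> k \<Longrightarrow> X $ i \<in> K"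
    using XS[unfolded S_def] by (metis singletonD, metis)
  have row_eq: "(X $ i v* B) $ j = (if i = j then 1 else 0)" for i j
  proof -
    have "(X $ i v* B) $ j = (X ** B) $ i $ j"
      by (simp add: vector_matrix_mult_def matrix_matrix_mult_def mult.commute)
    then show ?thesis by (simp add: XB mat_def)
  qed
  \<comment> \<open>Both functionals take the value 1 on row \<open>k\<close>, which is
    \<open>u\<close>, and 0 on the other rows, which lie in \<open>K\<close>.\<close>
  have coord_k: "(h v* B) $ k = w \<bullet> h" for h
  proof -
    have "h = (h v* B) v* X" by (simp add: vector_matrix_mul_assoc XB)
    also have "\<dots> = (\<Sum>i\<in>UNIV. (h v* B) $ i *\<^sub>R X $ i)"
      by (simp add: vec_eq_iff vector_matrix_mult_def mult.commute)
    finally have "w \<bullet> h = (\<Sum>i\<in>UNIV. (h v* B) $ i * (w \<bullet> X $ i))"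
      by (metis (no_types, lifting) inner_scaleR_right inner_sum_right sum.cong)
    also have "\<dots> = (\<Sum>i\<in>UNIV. if i = k then (h v* B) $ k else 0)"
      by (rule sum.cong) (use XK K_iff Xk wu in auto)
    finally show ?thesis by simp
  qed
  have \<nu>: "0 < \<nu>" "(real CARD('d) - 1) * \<nu> = 1" using assms(1,11) by auto
  \<comment> \<open>Column \<open>i\<close> of \<open>B\<close> is the \<open>i\<close>-th
    coordinate functional, so these are the matrix coordinates of \<open>A\<close> in the basis of
    rows of \<open>X\<close>.\<close>
  define A' where "A' i = (\<Sum>j\<in>UNIV. B $ j $ i *\<^sub>R A $ j)" for i
  define P where "P i \<sigma> = (1/2) *\<^sub>R (\<nu> *\<^sub>R A' k + \<sigma> *\<^sub>R A' i)" for i and \<sigma> :: real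
  let ?I = "(UNIV - {k}) \<times> {1, -1 :: real}"
  have psdP: "psd (P i \<sigma>)" if i: "i \<noteq> k" and \<sigma>: "\<sigma> \<in> {1, -1}" for i \<sigma>
  proof -
    \<comment> \<open>The functional that produces \<open>P i \<sigma>\<close> from the tuple
      \<open>A\<close>; it remains to show that it is nonnegative on the generators of the scaled
      cone.\<close>
    define z :: "real^'d" where "z = (\<chi> j. (\<nu> * B $ j $ k + \<sigma> * B $ j $ i) / 2)"
    have P_eq: "P i \<sigma> = (\<Sum>j\<in>UNIV. z $ j *\<^sub>R A $ j)"
      by (simp add: P_def A'_def z_def scaleR_sum_right sum.distrib[symmetric]
          scaleR_add_left[symmetric] add_divide_distrib)
    have z: "z \<bullet> a = (\<nu> * (a v* B) $ k + \<sigma> * (a v* B) $ i) / 2" for a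
      by (simp add: z_def inner_vec_def vector_matrix_mult_def sum_distrib_left
          sum.distrib[symmetric] sum_divide_distrib algebra_simps)
    show ?thesis
      unfolding P_eq
    proof (rule psd_combination_of_max_system[OF A])
      fix a assume "a \<in> scaled_cone H u \<nu> C"
      then show "0 \<le> z \<bullet> a"
        unfolding scaled_cone_def
      proof (rule conical_hull_subset_halfspace[rotated])
        fix a assume "a \<in> (\<lambda>x. u + \<nu> *\<^sub>R (x - u)) ` (C \<inter> (+) u ` H)"
        then obtain h where h: "h \<in> K" and a: "a = u + \<nu> *\<^sub>R h"
          unfolding K_def by auto
        have zu: "z \<bullet> u = \<nu> / 2"
          using i row_eq[of k] by (simp add: z Xk)
        have "\<bar>(h v* B) $ i\<bar> \<le> 1" using bound[of h i] h i by (simp add: S_def)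
        then have "- 1 \<le> \<sigma> * (h v* B) $ i" using \<sigma> by auto
        \<comment> \<open>The \<open>k\<close>-th coordinate of \<open>h\<close> is
          \<open>w \<bullet> h = 0\<close>, so only the Auerbach-bounded coordinate
          contributes.\<close>
        then have zh: "- (1/2) \<le> z \<bullet> h"
          using h by (simp add: z coord_k K_iff)
        have "z \<bullet> a = \<nu> / 2 + \<nu> * (z \<bullet> h)" by (simp add: a inner_add_right zu)
        also have "\<dots> \<ge> 0" using mult_left_mono[OF zh, of \<nu>] \<nu> by simp
        finally show "0 \<le> z \<bullet> a" .
      qed
    qed
  qed
  have "A = (\<Sum>(i,\<sigma>)\<in>?I. tensor (u + \<sigma> *\<^sub>R X $ i) (P i \<sigma>))"
  proof (subst vec_eq_iff, rule allI)
    fix j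
    \<comment> \<open>Terms of odd degree in \<sigma> cancel between the two signs, and \<sigma>
      squared is 1.\<close>
    have pair: "(\<Sum>\<sigma>\<in>{1, -1}. (u $ j + \<sigma> * X $ i $ j) *\<^sub>R P i \<sigma>)
        = \<nu> *\<^sub>R u $ j *\<^sub>R A' k + X $ i $ j *\<^sub>R A' i" for i
      by (simp add: P_def vec_eq_iff complex_eq_iff field_simps)
    have "(\<Sum>(i,\<sigma>)\<in>?I. tensor (u + \<sigma> *\<^sub>R X $ i) (P i \<sigma>)) $ j
        = (\<Sum>(i,\<sigma>)\<in>?I. (u $ j + \<sigma> * X $ i $ j) *\<^sub>R P i \<sigma>)"
      by (simp add: tensor_def split_def)
    also have "\<dots> = (\<Sum>i\<in>UNIV - {k}. \<nu> *\<^sub>R u $ j *\<^sub>R A' k + X $ i $ j *\<^sub>R A' i)"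
      by (simp only: sum.cartesian_product[symmetric] pair)
    \<comment> \<open>This is where the value of \<nu> matters: the \<open>d - 1\<close> copies of
      \<nu> add up to 1 and give exactly the missing summand \<open>i = k\<close>, because
      \<open>X $ k = u\<close>.\<close>
    also have "\<dots> = ((real CARD('d) - 1) * \<nu>) *\<^sub>R u $ j *\<^sub>R A' k
        + (\<Sum>i\<in>UNIV - {k}. X $ i $ j *\<^sub>R A' i)"
      using assms(1)
      by (simp add: sum.distrib sum_constant_scaleR of_nat_diff mult.assoc del: sum_constant)
    also have "\<dots> = (\<Sum>i\<in>UNIV. X $ i $ j *\<^sub>R A' i)"
      by (simp add: \<nu> sum.remove[of UNIV k] Xk)
    \<comment> \<open>Expanding \<open>A'\<close> and exchanging the sums changes back from the
      basis; \<open>B ** X = mat 1\<close> then leaves \<open>A $ j\<close>.\<close>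
    also have "\<dots> = (\<Sum>l\<in>UNIV. (B ** X) $ l $ j *\<^sub>R A $ l)"
      unfolding A'_def matrix_matrix_mult_def
      by (simp add: scaleR_sum_right scaleR_sum_left mult.commute) (rule sum.swap)
    also have "\<dots> = (\<Sum>l\<in>UNIV. if l = j then A $ j else 0)"
      by (rule sum.cong) (auto simp: XB mat_def)
    finally show "A $ j = (\<Sum>(i,\<sigma>)\<in>?I. tensor (u + \<sigma> *\<^sub>R X $ i) (P i \<sigma>)) $ j"
      by simp
  qed
  also have "\<dots> \<in> min_system C"
    unfolding split_def
  proof (rule sum_in_min_system)
    have "u + X $ i \<in> C" "u - X $ i \<in> C" if "i \<noteq> k" for i
      using XK[OF that] K_iff Kminus by blast+
    then show "u + snd p *\<^sub>R X $ fst p \<in> C" if "p \<in> ?I" for p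
      using that by force
    show "psd (P (fst p) (snd p))" if "p \<in> ?I" for p
      using that by (intro psdP) auto
  qed simp
  finally show "A \<in> min_system C" .
qed

end
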